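(* Let $h\in\mathcal{H}(\theta)$ be such that $T(x):=F(x)+H(x)$, a symmetric matrix of size $n_M\times n_M$ with $n_M=n(\theta+1)$, has entries that are polynomials in $x$. If there exists $N(x)\in\Sigma^{n_M\times n_M}[x]$ such that $$T(x) - N(x)\,x(1-x) \in \Sigma^{n_M\times n_M}[x],$$ then $T(x)\ge 0$ for all $x\in\Omega=[0,1]$.
   Context: $\Sigma^{m\times m}[x]$ denotes the set of sum-of-squares $m\times m$ matrix polynomials in the real variable $x$, i.e. those of the form $M(x)^{T}M(x)$ for some (possibly rectangular) real polynomial matrix $M(x)$ with $m$ columns. For a symmetric matrix $A$, $A\ge0$ means positive semidefinite. Let $\Omega=[0,1]$, let $n\ge 1$ and $\theta \ge 1$ be integers. For $u=(u_1,\dots,u_n)\in \mathcal{C}^{\theta}(\Omega;\mathbb{R}^n)$ and an integer $0\le s\le\theta$, $v_s(u) = (\partial_x^i u_j)_{1\le j\le n,\ 0\le i\le s}\in\mathbb{R}^{n(s+1)}$ denotes the vector of all $u_j$ and their derivatives up to order $s$. Fix a real matrix $B$ with $n_b$ rows and $2n\theta$ columns, and let $\mathcal{U}$ be the set of $u\in \mathcal{C}^{\theta}(\Omega;\mathbb{R}^n)$ with $$B\begin{bmatrix} v_{\theta-1}(u)(1)\\ v_{\theta-1}(u)(0)\end{bmatrix}=0 .$$ Let $F:\Omega\to\mathbb{R}^{n(\theta+1)\times n(\theta+1)}$ be continuous with symmetric values. Let $v_{s}^{\{2\}}(u)$ be the vector of all monomials of degree $2$ in the entries of $v_{s}(u)$,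 let $n_r$ be the length of $v_{\theta-1}^{\{2\}}(u)$, and let $C$ be the constant matrix with $\frac{\partial}{\partial x} v_{\theta-1}^{\{2\}}(u) = C\, v_\theta^{\{2\}}(u)$. With $\odot$ the elementwise product, $\preceq$ elementwise inequality, and $g|_{\partial\Omega}:=g(1)-g(0)$, define $$\mathcal{H}(\theta) := \left\{ h\in \mathcal{C}^1(\Omega;\mathbb{R}^{n_r}) : \big(h\odot v_{\theta-1}^{\{2\}}(u)\big)\big|_{\partial\Omega}\preceq 0 \ \text{ for all } u\in\mathcal{U}\right\}.$$ For $h\in\mathcal{H}(\theta)$ put $\bar h(x,v_\theta) := h_x(x)\odot v_{\theta-1}^{\{2\}} + h(x)\odot C\,v_\theta^{\{2\}}\in\mathbb{R}^{n_r}$, and let $H(x)$ be the symmetric matrix with $\sum_{i=1}^{n_r}\bar h_i(x,v_\theta) = v_\theta^{T}H(x)v_\theta$ (the entries of $v_\theta$ being regarded as independent variables). *)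

theory Defs
  imports "HOL-Analysis.Derivative" "HOL-Computational_Algebra.Polynomial"
    "Jordan_Normal_Form.Matrix"
begin

unbundle no inner_syntax
unbundle no vec_syntax

definition symmetric_mat :: "nat \<Rightarrow> real mat \<Rightarrow> bool" where
  "symmetric_mat m A \<longleftrightarrow> A \<in> carrier_mat m m \<and> transpose_mat A = A"

definition psd_mat :: "nat \<Rightarrow> real mat \<Rightarrow> bool" where
  "psd_mat m A \<longleftrightarrow> symmetric_mat m A \<and> (\<forall>z\<in>carrier_vec m. 0 \<le> z \<bullet> (A *\<^sub>v z))"

definition poly_mat_eval :: "real poly mat \<Rightarrow> real \<Rightarrow> real mat" where
  "poly_mat_eval P x = map_mat (\<lambda>p. poly p x) P"

definition sos_mats :: "nat \<Rightarrow> real poly mat set" where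
  "sos_mats m = {transpose_mat M * M | M. \<exists>k. M \<in> carrier_mat k m}"

text \<open>Derivatives are taken within \<open>[0,1]\<close>, hence one-sided at the end points, and only the
  values on \<open>[0,1]\<close> matter.\<close>

definition dx :: "(real \<Rightarrow> real) \<Rightarrow> real \<Rightarrow> real" where
  "dx f x = vector_derivative f (at x within {0..1})"

definition Ck :: "nat \<Rightarrow> (real \<Rightarrow> real) \<Rightarrow> bool" where
  "Ck k f \<longleftrightarrow>
     (\<forall>i<k. (dx ^^ i) f differentiable_on {0..1}) \<and> continuous_on {0..1} ((dx ^^ k) f)"

definition Ck_vec :: "nat \<Rightarrow> nat \<Rightarrow> (real \<Rightarrow> real vec) \<Rightarrow> bool" where
  "Ck_vec k m u \<longleftrightarrow>
     (\<forall>x\<in>{0..1}. u x \<in> carrier_vec m) \<and> (\<forall>j<m. Ck k (\<lambda>x. u x $ j))"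

text \<open>The vector \<open>v\<^sub>s(u)(x)\<close>. Everything is indexed from 0, and the entries are ordered as
  \<open>u\<^sub>0, \<partial>u\<^sub>0, \<dots>, \<partial>\<^sup>su\<^sub>0, u\<^sub>1, \<partial>u\<^sub>1, \<dots>\<close>, so that \<open>\<partial>\<^sup>iu\<^sub>j\<close> sits at position \<open>j * (s + 1) + i\<close>.\<close>

definition jet :: "nat \<Rightarrow> nat \<Rightarrow> (real \<Rightarrow> real vec) \<Rightarrow> real \<Rightarrow> real vec" where
  "jet n s u x =
     vec (n * (s + 1)) (\<lambda>p. (dx ^^ (p mod (s + 1))) (\<lambda>y. u y $ (p div (s + 1))) x)"

text \<open>The subvector \<open>v\<^bsub>s-1\<^esub>\<close> of \<open>v\<^sub>s\<close>, the entries of the latter being independent variables.\<close>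

definition lower_jet :: "nat \<Rightarrow> nat \<Rightarrow> real vec \<Rightarrow> real vec" where
  "lower_jet n s z = vec (n * s) (\<lambda>p. z $ ((p div s) * (s + 1) + p mod s))"

lemma lower_jet_jet:
  assumes "s \<ge> 1"
  shows "lower_jet n s (jet n s u x) = jet n (s - 1) u x"
proof (rule eq_vecI)
  fix p assume "p < dim_vec (jet n (s - 1) u x)"
  then have p: "p < n * s" using assms by (simp add: jet_def)
  have lt: "p mod s < s" using assms by simp
  have "p div s < n" using p by (simp add: less_mult_imp_div_less)
  then have "(p div s) * (s + 1) + (s + 1) \<le> n * (s + 1)"
    using mult_le_mono1[of "p div s + 1" n "s + 1"] by (simp only: add_mult_distrib) simp
  moreover have "(p div s) * (s + 1) + p mod s < (p div s) * (s + 1) + (s + 1)"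
    using lt by (intro add_strict_left_mono) simp
  ultimately have "(p div s) * (s + 1) + p mod s < n * (s + 1)" by linarith
  moreover have "((p div s) * (s + 1) + p mod s) div (s + 1) = p div s"
    using lt by (subst div_mult_self3) simp_all
  moreover have "((p div s) * (s + 1) + p mod s) mod (s + 1) = p mod s"
    using lt by (metis add.commute less_SucI mod_less mod_mult_self2 mult.commute Suc_eq_plus1)
  ultimately show "lower_jet n s (jet n s u x) $ p = jet n (s - 1) u x $ p"
    using p assms by (simp add: lower_jet_def jet_def)
qed (use assms in \<open>simp add: lower_jet_def jet_def\<close>)

definition mon2 :: "real vec \<Rightarrow> real vec" where
  "mon2 z = vec_of_list [z $ p * z $ q. p \<leftarrow> [0..<dim_vec z], q \<leftarrow> [p..<dim_vec z]]"

definition mon2_dim :: "nat \<Rightarrow> nat" where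
  "mon2_dim N = N * (N + 1) div 2"

lemma dim_mon2: "dim_vec (mon2 z) = mon2_dim (dim_vec z)"
proof -
  have *: "(\<Sum>p<N. N - p) = N * (N + 1) div 2" for N :: nat
    by (induction N) (simp_all add: sum.lessThan_Suc_shift del: sum.lessThan_Suc)
  show ?thesis
    unfolding mon2_def mon2_dim_def
    by (simp add: length_concat comp_def interv_sum_list_conv_sum_set_nat atLeast0LessThan *)
qed

text \<open>Says that \<open>C\<close> is the constant matrix with \<open>\<partial> v\<^bsub>\<theta>-1\<^esub>\<^sup>2(u) = C v\<^sub>\<theta>\<^sup>2(u)\<close>; \<open>u\<close> ranges over all
  of \<open>C\<^sup>\<theta>\<close>, without boundary conditions.\<close>

definition is_mon2_deriv_mat :: "nat \<Rightarrow> nat \<Rightarrow> real mat \<Rightarrow> bool" where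
  "is_mon2_deriv_mat n \<theta> C \<longleftrightarrow>
     C \<in> carrier_mat (mon2_dim (n * \<theta>)) (mon2_dim (n * (\<theta> + 1))) \<and>
     (\<forall>u. Ck_vec \<theta> n u \<longrightarrow>
        (\<forall>x\<in>{0..1}. \<forall>r<mon2_dim (n * \<theta>).
           ((\<lambda>y. mon2 (jet n (\<theta> - 1) u y) $ r) has_real_derivative
              (C *\<^sub>v mon2 (jet n \<theta> u x)) $ r) (at x within {0..1})))"

definition bc_space :: "nat \<Rightarrow> nat \<Rightarrow> real mat \<Rightarrow> (real \<Rightarrow> real vec) set" where
  "bc_space n \<theta> B =
     {u. Ck_vec \<theta> n u \<and>
         B *\<^sub>v (jet n (\<theta> - 1) u 1 @\<^sub>v jet n (\<theta> - 1) u 0) = 0\<^sub>v (dim_row B)}"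

definition hadamard_vec :: "real vec \<Rightarrow> real vec \<Rightarrow> real vec" (infixl \<open>\<odot>\<^sub>v\<close> 70) where
  "v \<odot>\<^sub>v w = vec (dim_vec v) (\<lambda>i. v $ i * w $ i)"

definition h_space :: "nat \<Rightarrow> nat \<Rightarrow> real mat \<Rightarrow> (real \<Rightarrow> real vec) set" where
  "h_space n \<theta> B =
     {h. Ck_vec 1 (mon2_dim (n * \<theta>)) h \<and>
         (\<forall>u\<in>bc_space n \<theta> B.
            h 1 \<odot>\<^sub>v mon2 (jet n (\<theta> - 1) u 1) - h 0 \<odot>\<^sub>v mon2 (jet n (\<theta> - 1) u 0)
              \<le> 0\<^sub>v (mon2_dim (n * \<theta>)))}"

definition h_bar ::
  "nat \<Rightarrow> nat \<Rightarrow> real mat \<Rightarrow> (real \<Rightarrow> real vec) \<Rightarrow> real \<Rightarrow> real vec \<Rightarrow> real vec" where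
  "h_bar n \<theta> C h x z =
     vec (mon2_dim (n * \<theta>)) (\<lambda>r. dx (\<lambda>y. h y $ r) x) \<odot>\<^sub>v mon2 (lower_jet n \<theta> z)
       + h x \<odot>\<^sub>v (C *\<^sub>v mon2 z)"

text \<open>Says that on \<open>[0,1]\<close> the matrix \<open>H x\<close> is the symmetric matrix of the quadratic form
  \<open>z \<mapsto> \<Sum>\<^sub>r h_bar\<^sub>r(x, z)\<close>.\<close>

definition is_h_bar_mat ::
  "nat \<Rightarrow> nat \<Rightarrow> real mat \<Rightarrow> (real \<Rightarrow> real vec) \<Rightarrow> (real \<Rightarrow> real mat) \<Rightarrow> bool" where
  "is_h_bar_mat n \<theta> C h H \<longleftrightarrow>
     (\<forall>x\<in>{0..1}. symmetric_mat (n * (\<theta> + 1)) (H x) \<and>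
        (\<forall>z\<in>carrier_vec (n * (\<theta> + 1)).
           (\<Sum>r<mon2_dim (n * \<theta>). h_bar n \<theta> C h x z $ r) = z \<bullet> (H x *\<^sub>v z)))"

end

theory Submission
  imports Defs
begin

text \<open>Evaluating a polynomial identity between matrices at a real point \<open>x\<close> is compatible with all
  matrix operations. Hence a sum of squares \<open>M\<^sup>T M\<close> becomes a Gram matrix of real numbers, whose
  quadratic form at \<open>z\<close> is the square length of \<open>M(x) z\<close>, so it is positive semidefinite
  (\<open>psd_mat_eval_sos\<close>). Now write \<open>T = (T - x (1 - x) N) + x (1 - x) N\<close>. At a point of \<open>[0,1]\<close> the
  factor \<open>x (1 - x)\<close> is nonnegative, and the positive semidefinite matrices form a convex cone, so
  \<open>T(x)\<close> is positive semidefinite.\<close>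

lemma psd_mat_add:
  assumes "psd_mat m A" and "psd_mat m B"
  shows "psd_mat m (A + B)"
proof -
  have A: "A \<in> carrier_mat m m" and B: "B \<in> carrier_mat m m"
    using assms by (auto simp: psd_mat_def symmetric_mat_def)
  have "0 \<le> z \<bullet> ((A + B) *\<^sub>v z)" if z: "z \<in> carrier_vec m" for z
  proof -
    have "z \<bullet> ((A + B) *\<^sub>v z) = z \<bullet> (A *\<^sub>v z) + z \<bullet> (B *\<^sub>v z)"
      using A B z by (simp add: add_mult_distrib_mat_vec[of A m m] scalar_prod_add_distrib[of _ m])
    then show ?thesis
      using assms z by (simp add: psd_mat_def)
  qed
  moreover have "symmetric_mat m (A + B)"
    using assms A B by (simp add: psd_mat_def symmetric_mat_def transpose_add[of A m m])
  ultimately show ?thesis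
    by (simp add: psd_mat_def)
qed

lemma psd_mat_smult:
  assumes "psd_mat m A" and "0 \<le> c"
  shows "psd_mat m (c \<cdot>\<^sub>m A)"
proof -
  have A: "A \<in> carrier_mat m m"
    using assms by (simp add: psd_mat_def symmetric_mat_def)
  have "0 \<le> z \<bullet> ((c \<cdot>\<^sub>m A) *\<^sub>v z)" if z: "z \<in> carrier_vec m" for z
  proof -
    have "(c \<cdot>\<^sub>m A) *\<^sub>v z = c \<cdot>\<^sub>v (A *\<^sub>v z)"
      using A z by (intro eq_vecI) auto
    then have "z \<bullet> ((c \<cdot>\<^sub>m A) *\<^sub>v z) = c * (z \<bullet> (A *\<^sub>v z))"
      using A z by simp
    then show ?thesis
      using assms z by (simp add: psd_mat_def)
  qed
  moreover have "transpose_mat (c \<cdot>\<^sub>m A) = c \<cdot>\<^sub>m transpose_mat A"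
    by (rule eq_matI) auto
  then have "symmetric_mat m (c \<cdot>\<^sub>m A)"
    using assms A by (simp add: psd_mat_def symmetric_mat_def)
  ultimately show ?thesis
    by (simp add: psd_mat_def)
qed

text \<open>The quadratic form of \<open>M\<^sup>T M\<close> is \<open>z \<mapsto> (M z) \<bullet> (M z)\<close>.\<close>

lemma psd_mat_gram:
  fixes M :: "real mat"
  assumes M: "M \<in> carrier_mat k m"
  shows "psd_mat m (transpose_mat M * M)"
proof -
  have "0 \<le> z \<bullet> ((transpose_mat M * M) *\<^sub>v z)" if z: "z \<in> carrier_vec m" for z
  proof -
    have Mz: "M *\<^sub>v z \<in> carrier_vec k"
      using M z by simp
    have "z \<bullet> ((transpose_mat M * M) *\<^sub>v z) = z \<bullet> (transpose_mat M *\<^sub>v (M *\<^sub>v z))"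
      using M z by (simp add: assoc_mult_mat_vec[of "transpose_mat M" m k M m])
    also have "\<dots> = (transpose_mat M *\<^sub>v (M *\<^sub>v z)) \<bullet> z"
      using M Mz z by (intro comm_scalar_prod[of _ m]) auto
    also have "\<dots> = (M *\<^sub>v z) \<bullet> (M *\<^sub>v z)"
      using transpose_vec_mult_scalar[OF M z Mz] .
    also have "0 \<le> \<dots>"
      by (simp add: scalar_prod_def sum_nonneg)
    finally show ?thesis .
  qed
  moreover have "symmetric_mat m (transpose_mat M * M)"
    using M by (simp add: symmetric_mat_def transpose_mult[of "transpose_mat M" m k M m])
  ultimately show ?thesis
    by (simp add: psd_mat_def)
qed

lemma poly_mat_eval_mult:
  assumes "P \<in> carrier_mat k l" and "Q \<in> carrier_mat l m"
  shows "poly_mat_eval (P * Q) x = poly_mat_eval P x * poly_mat_eval Q x"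
proof -
  interpret semiring_hom "\<lambda>p :: real poly. poly p x"
    by unfold_locales simp_all
  show ?thesis
    using assms unfolding poly_mat_eval_def by (rule mat_hom_mult)
qed

lemma psd_mat_eval_sos:
  assumes "P \<in> sos_mats m"
  shows "psd_mat m (poly_mat_eval P x)"
proof -
  obtain M k where M: "M \<in> carrier_mat k m" and P: "P = transpose_mat M * M"
    using assms by (auto simp: sos_mats_def)
  have "poly_mat_eval P x = poly_mat_eval (transpose_mat M) x * poly_mat_eval M x"
    unfolding P using M by (intro poly_mat_eval_mult) auto
  also have "poly_mat_eval (transpose_mat M) x = transpose_mat (poly_mat_eval M x)"
    by (rule eq_matI) (auto simp: poly_mat_eval_def)
  finally show ?thesis
    using M by (auto simp: poly_mat_eval_def intro: psd_mat_gram)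
qed

text \<open>The matrix form of the easy direction of the univariate Positivstellensatz: a weighted
  sum-of-squares certificate proves positivity wherever the weight is nonnegative.\<close>

lemma psd_mat_eval_certificate:
  assumes T: "T \<in> carrier_mat m m"
    and N: "N \<in> sos_mats m"
    and cert: "T - g \<cdot>\<^sub>m N \<in> sos_mats m"
    and g: "0 \<le> poly g x"
  shows "psd_mat m (poly_mat_eval T x)"
proof -
  have "N \<in> carrier_mat m m"
    using N by (auto simp: sos_mats_def)
  then have "poly_mat_eval T x = poly_mat_eval (T - g \<cdot>\<^sub>m N) x + poly g x \<cdot>\<^sub>m poly_mat_eval N x"
    using T by (intro eq_matI) (auto simp: poly_mat_eval_def)
  then show ?thesis
    using psd_mat_add psd_mat_smult psd_mat_eval_sos N cert g by simp
qed

theorem corollary2: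
  fixes n \<theta> n\<^sub>b :: nat
    and B C :: "real mat"
    and F H :: "real \<Rightarrow> real mat"
    and h :: "real \<Rightarrow> real vec"
    and T :: "real poly mat"
  assumes "n \<ge> 1" and "\<theta> \<ge> 1"
    and "B \<in> carrier_mat n\<^sub>b (2 * n * \<theta>)"
    and "\<forall>x\<in>{0..1}. symmetric_mat (n * (\<theta> + 1)) (F x)"
    and "\<forall>i<n * (\<theta> + 1). \<forall>j<n * (\<theta> + 1). continuous_on {0..1} (\<lambda>x. F x $$ (i, j))"
    and "is_mon2_deriv_mat n \<theta> C"
    and "h \<in> h_space n \<theta> B"
    and "is_h_bar_mat n \<theta> C h H"
    and "T \<in> carrier_mat (n * (\<theta> + 1)) (n * (\<theta> + 1))"
    and "\<forall>x\<in>{0..1}. F x + H x = poly_mat_eval T x"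
    and "\<exists>N\<in>sos_mats (n * (\<theta> + 1)).
           T - ([:0, 1:] * (1 - [:0, 1:])) \<cdot>\<^sub>m N \<in> sos_mats (n * (\<theta> + 1))"
  shows "\<forall>x\<in>{0..1}. psd_mat (n * (\<theta> + 1)) (F x + H x)"
proof
  fix x :: real
  assume x: "x \<in> {0..1}"
  obtain N where "N \<in> sos_mats (n * (\<theta> + 1))"
    and "T - ([:0, 1:] * (1 - [:0, 1:])) \<cdot>\<^sub>m N \<in> sos_mats (n * (\<theta> + 1))"
    using assms(11) by blast
  moreover have "0 \<le> poly ([:0, 1:] * (1 - [:0, 1:])) x"
    using x by simp
  ultimately have "psd_mat (n * (\<theta> + 1)) (poly_mat_eval T x)"
    using psd_mat_eval_certificate[OF assms(9)] by blast
  then show "psd_mat (n * (\<theta> + 1)) (F x + H x)"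
    using assms(10) x by simp
qed

end
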